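(* One has $$\vartheta_{\rm adaptive}(S,s)\le\vartheta_{\rm cumulative}(S):=\frac{\sqrt s\,\sqrt{\sum_{k\in S}\bigl(\sum_{j\notin S}|\sigma_{j,k}|\bigr)^2}}{\Lambda^2(S,s)},$$ and $$\vartheta(S,2s)\le\max_{\mathcal N\supset S,\,|\mathcal N|=2s}\frac{\sqrt{\sum_{k\in\mathcal N}\bigl(\sum_{j\notin\mathcal N}|\sigma_{j,k}|\bigr)^2}}{\sqrt s\,\Lambda^2(S,2s)} .$$
   Context: $Q$ is a probability measure on a measurable space, $\psi_1,\dots,\psi_p\in L_2(Q)$ are real functions, $(\cdot,\cdot)$ and $\|\cdot\|$ are the inner product and norm of $L_2(Q)$, and $f_\beta:=\sum_{j=1}^p\beta_j\psi_j$ for $\beta\in\mathbb{R}^p$. The Gram matrix is $\Sigma=(\sigma_{j,k})$, $\sigma_{j,k}:=(\psi_j,\psi_k)$. $S\subset\{1,\dots,p\}$ is a nonempty index set, $s:=|S|$, $p\ge2s$. For an index set $\mathcal N$, $\beta_{\mathcal N}$ is the vector with entries $\beta_j1\{j\in\mathcal N\}$. For $N\ge s$, $\Lambda^2(S,N)$ is the infimum of the smallest eigenvalue of $(\sigma_{j,k})_{j,k\in\mathcal N}$ over $\mathcal N\supset S$ with $|\mathcal N|\le N$. Standing assumption: $\Lambda^2(S,s)>0$; the second inequality presupposes $\Lambda^2(S,2s)>0$. The adaptive $(S,s)$-restricted regression (where $\mathcal N\supset S$, $|\mathcal N|\le s$ forces $\mathcal N=S$) is $$\vartheta_{\rm adaptive}(S,s):=\max\left\{\frac{|(f_{\beta_S},f_{\beta_{S^c}})|}{\|f_{\beta_S}\|^2}:\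 \|\beta_{S^c}\|_1\le\sqrt s\,\|\beta_S\|_2\right\}.$$ $\mathcal R(S)$ is the set of $\beta\in\mathbb{R}^p$ with $\|\beta_{S^c}\|_1\le\|\beta_S\|_1\ne0$. For $\mathcal N\supset S$, $\mathcal R(S,\mathcal N)$ is the set of $\beta\in\mathcal R(S)$ with $\|\beta_{\mathcal N^c}\|_\infty\le\min_{j\in\mathcal N\setminus S}|\beta_j|$, with the convention $\mathcal R(S,S)=\mathcal R(S)$ when $\mathcal N=S$. The $(S,2s)$-restricted regression is $$\vartheta(S,2s):=\max\left\{\frac{|(f_{\beta_{\mathcal N}},f_{\beta_{\mathcal N^c}})|}{\|f_{\beta_{\mathcal N}}\|^2}:\ \mathcal N\supset S,\ |\mathcal N|\le2s,\ \beta\in\mathcal R(S,\mathcal N)\right\}.$$ The maxima are over those $\beta$ for which the ratio is defined.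
   Formalization: In ϑ(S,2s) the maximum is taken over N ⊃ S with |N| = 2s instead of |N| ≤ 2s; with |N| ≤ 2s the second inequality is false, e.g. p=2, S={1}, Σ=[[5,3],[3,5]], where N=S gives ratio 3/5 but the right-hand side is 0. *)

theory Defs
  imports "HOL-Probability.Probability"
begin

section \<open>Real functions in $L_2(Q)$\<close>

definition square_integrable :: "'a measure \<Rightarrow> ('a \<Rightarrow> real) \<Rightarrow> bool" where
  "square_integrable Q f \<longleftrightarrow> f \<in> borel_measurable Q \<and> integrable Q (\<lambda>x. (f x)\<^sup>2)"

definition l2_inner :: "'a measure \<Rightarrow> ('a \<Rightarrow> real) \<Rightarrow> ('a \<Rightarrow> real) \<Rightarrow> real" where
  "l2_inner Q f g = (LINT x|Q. f x * g x)"

definition l2_norm :: "'a measure \<Rightarrow> ('a \<Rightarrow> real) \<Rightarrow> real" where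
  "l2_norm Q f = sqrt (l2_inner Q f f)"


section \<open>Coefficient vectors and the Gram matrix\<close>

text \<open>The finite index type \<open>'p\<close> plays the role of $\{1,\dots,p\}$, so $p$ is \<open>CARD('p)\<close>.\<close>

definition lin_comb :: "('p::finite \<Rightarrow> 'a \<Rightarrow> real) \<Rightarrow> real ^ 'p \<Rightarrow> 'a \<Rightarrow> real" where
  "lin_comb \<psi> \<beta> = (\<lambda>x. \<Sum>j\<in>UNIV. \<beta> $ j * \<psi> j x)"

definition restr :: "real ^ 'p \<Rightarrow> 'p set \<Rightarrow> real ^ ('p::finite)" where
  "restr \<beta> N = (\<chi> j. if j \<in> N then \<beta> $ j else 0)"

definition l1_norm :: "real ^ ('p::finite) \<Rightarrow> real" where
  "l1_norm \<beta> = (\<Sum>j\<in>UNIV. \<bar>\<beta> $ j\<bar>)"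

definition gram :: "'a measure \<Rightarrow> ('p::finite \<Rightarrow> 'a \<Rightarrow> real) \<Rightarrow> real ^ 'p ^ 'p" where
  "gram Q \<psi> = (\<chi> j k. l2_inner Q (\<psi> j) (\<psi> k))"


section \<open>Smallest eigenvalues of principal submatrices\<close>

text \<open>Eigenvalues of $(A_{j,k})_{j,k\in N}$. Only the entries of the vector \<open>v\<close> with index in
  \<open>N\<close> are used, so \<open>v\<close> represents a vector indexed by \<open>N\<close>.\<close>

definition submatrix_eigenvalues :: "real ^ 'p ^ 'p \<Rightarrow> ('p::finite) set \<Rightarrow> real set" where
  "submatrix_eigenvalues A N =
     {e. \<exists>v :: 'p \<Rightarrow> real. (\<exists>j\<in>N. v j \<noteq> 0) \<and> (\<forall>j\<in>N. (\<Sum>k\<in>N. A $ j $ k * v k) = e * v j)}"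

text \<open>For nonempty \<open>N\<close> and symmetric \<open>A\<close> (such as a Gram matrix), the set of eigenvalues is finite
  and nonempty.\<close>

definition smallest_eigenvalue :: "real ^ 'p ^ 'p \<Rightarrow> ('p::finite) set \<Rightarrow> real" where
  "smallest_eigenvalue A N = Min (submatrix_eigenvalues A N)"

definition Lambda_sq :: "real ^ 'p ^ 'p \<Rightarrow> ('p::finite) set \<Rightarrow> nat \<Rightarrow> real" where
  "Lambda_sq A S n = (INF N\<in>{N. S \<subseteq> N \<and> card N \<le> n}. smallest_eigenvalue A N)"


section \<open>Restricted regressions\<close>

definition regression_ratio ::
  "'a measure \<Rightarrow> ('p::finite \<Rightarrow> 'a \<Rightarrow> real) \<Rightarrow> 'p set \<Rightarrow> real ^ 'p \<Rightarrow> real" where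
  "regression_ratio Q \<psi> N \<beta> =
     \<bar>l2_inner Q (lin_comb \<psi> (restr \<beta> N)) (lin_comb \<psi> (restr \<beta> (- N)))\<bar>
       / (l2_norm Q (lin_comb \<psi> (restr \<beta> N)))\<^sup>2"

text \<open>The maxima are rendered as suprema in \<^typ>\<open>ereal\<close>: unlike the real supremum, this has no
  arbitrary value on unbounded sets, so an upper bound on it bounds every ratio. The condition
  that the norm is nonzero restricts to those \<open>\<beta>\<close> for which the ratio is defined.\<close>

definition theta_adaptive ::
  "'a measure \<Rightarrow> ('p::finite \<Rightarrow> 'a \<Rightarrow> real) \<Rightarrow> 'p set \<Rightarrow> ereal" where
  "theta_adaptive Q \<psi> S =
     Sup {ereal (regression_ratio Q \<psi> S \<beta>) | \<beta>.
            l1_norm (restr \<beta> (- S)) \<le> sqrt (real (card S)) * norm (restr \<beta> S) \<and>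
            l2_norm Q (lin_comb \<psi> (restr \<beta> S)) \<noteq> 0}"

definition theta_cumulative ::
  "'a measure \<Rightarrow> ('p::finite \<Rightarrow> 'a \<Rightarrow> real) \<Rightarrow> 'p set \<Rightarrow> real" where
  "theta_cumulative Q \<psi> S =
     sqrt (real (card S)) * sqrt (\<Sum>k\<in>S. (\<Sum>j\<in>- S. \<bar>gram Q \<psi> $ j $ k\<bar>)\<^sup>2)
       / Lambda_sq (gram Q \<psi>) S (card S)"

definition cone :: "('p::finite) set \<Rightarrow> (real ^ 'p) set" where
  "cone S = {\<beta>. l1_norm (restr \<beta> (- S)) \<le> l1_norm (restr \<beta> S) \<and> l1_norm (restr \<beta> S) \<noteq> 0}"

definition restricted_cone :: "('p::finite) set \<Rightarrow> 'p set \<Rightarrow> (real ^ 'p) set" where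
  "restricted_cone S N =
     {\<beta> \<in> cone S. N = S \<or> infnorm (restr \<beta> (- N)) \<le> Min ((\<lambda>j. \<bar>\<beta> $ j\<bar>) ` (N - S))}"

text \<open>The index sets \<open>N\<close> have exactly \<open>n\<close> elements. With $|N| \le n$ instead, the bound on
  $\vartheta(S,2s)$ by a maximum over $|N| = 2s$ is false: for $p = 2$ and $S = \{1\}$, the choice
  $N = S$ contributes the ratio $|\sigma_{1,2}| / \sigma_{1,1}$, while the only set with $|N| = 2$
  has empty complement, so that the bound is 0.\<close>

definition theta_restricted ::
  "'a measure \<Rightarrow> ('p::finite \<Rightarrow> 'a \<Rightarrow> real) \<Rightarrow> 'p set \<Rightarrow> nat \<Rightarrow> ereal" where
  "theta_restricted Q \<psi> S n =
     Sup {ereal (regression_ratio Q \<psi> N \<beta>) | N \<beta>.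
            S \<subseteq> N \<and> card N = n \<and> \<beta> \<in> restricted_cone S N \<and>
            l2_norm Q (lin_comb \<psi> (restr \<beta> N)) \<noteq> 0}"

end

theory Submission
  imports Defs
begin

text \<open>Bounding the coefficients outside \<open>N\<close> by their maximum and applying Cauchy--Schwarz to the
  coefficients in \<open>N\<close> gives
  $|(f_{\beta_N}, f_{\beta_{N^c}})| \le \|\beta_{N^c}\|_\infty \|\beta_N\|_2
  (\sum_{k\in N} (\sum_{j\notin N} |\sigma_{j,k}|)^2)^{1/2}$, while the smallest eigenvalue bounds
  $\|f_{\beta_N}\|^2$ from below by $\Lambda^2 \|\beta_N\|_2^2$. It remains to compare
  $\|\beta_{N^c}\|_\infty$ with $\|\beta_N\|_2$. In the adaptive case it is at most
  $\|\beta_{S^c}\|_1 \le \sqrt s \|\beta_S\|_2$. In the restricted case each of the \<open>s\<close>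
  coefficients in $N \setminus S$ is at least $\|\beta_{N^c}\|_\infty$ in absolute value, so that
  $\sqrt s \|\beta_{N^c}\|_\infty \le \|\beta_N\|_2$.\<close>

section \<open>Spectral facts for self-adjoint maps\<close>

text \<open>A minimizer of the quadratic form on the compact unit sphere of \<open>V\<close> is an
  eigenvector, because the first variation in the direction of its residual must vanish. Working on
  an invariant subspace makes this applicable to principal submatrices.\<close>

lemma self_adjoint_min_eigenvector:
  fixes T :: "'a::euclidean_space \<Rightarrow> 'a"
  assumes lin: "linear T" and adj: "\<And>v w. T v \<bullet> w = v \<bullet> T w"
    and V: "subspace V" and inv: "\<And>v. v \<in> V \<Longrightarrow> T v \<in> V" and ne: "\<exists>v\<in>V. v \<noteq> 0"
  obtains e v where "v \<in> V" "v \<noteq> 0" "T v = e *\<^sub>R v" "\<And>w. w \<in> V \<Longrightarrow> e * (w \<bullet> w) \<le> w \<bullet> T w"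
proof -
  define K where "K = V \<inter> sphere 0 1"
  have "compact K"
    unfolding K_def using closed_subspace[OF V] by (intro closed_Int_compact) auto
  moreover obtain v0 where "v0 \<in> V" "v0 \<noteq> 0" using ne by blast
  then have "(1 / norm v0) *\<^sub>R v0 \<in> K"
    unfolding K_def using subspace_scale[OF V] by simp
  then have "K \<noteq> {}" by blast
  moreover have "continuous_on K (\<lambda>v. v \<bullet> T v)"
    by (intro continuous_intros linear_continuous_on linear_linear[THEN iffD2] lin)
  ultimately obtain v where v: "v \<in> K" and vmin: "\<And>w. w \<in> K \<Longrightarrow> v \<bullet> T v \<le> w \<bullet> T w"
    by (meson continuous_attains_inf)
  define e where "e = v \<bullet> T v"
  have vV: "v \<in> V" and vv: "v \<bullet> v = 1"
    using v by (auto simp: K_def dot_square_norm)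
  have min: "e * (w \<bullet> w) \<le> w \<bullet> T w" if "w \<in> V" for w
  proof (cases "w = 0")
    case False
    define u where "u = (1 / norm w) *\<^sub>R w"
    have "u \<in> K" unfolding u_def K_def using False that subspace_scale[OF V] by simp
    then have "e \<le> u \<bullet> T u" unfolding e_def by (rule vmin)
    also have "u \<bullet> T u = (w \<bullet> T w) / (w \<bullet> w)"
      unfolding u_def by (simp add: linear_scale[OF lin] dot_square_norm power2_eq_square)
    finally show ?thesis using False by (simp add: field_simps)
  qed simp
  \<comment> \<open>The residual, to be shown zero. By invariance it lies in \<open>V\<close>, so it
    is an admissible direction.\<close>
  define u where "u = T v - e *\<^sub>R v"
  define c where "c = u \<bullet> T u - e * (u \<bullet> u)"
  have uV: "u \<in> V"
    unfolding u_def using V inv vV by (intro subspace_diff subspace_scale) auto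
  \<comment> \<open>Expand the form around \<open>v\<close>: the constant term vanishes by the
    choice of \<open>e\<close>, and the linear coefficient is the inner product of \<open>u\<close>
    with the residual, which is \<open>u\<close> itself.\<close>
  have perturb: "0 \<le> 2 * t * (u \<bullet> u) + t\<^sup>2 * c" for t
  proof -
    have "v + t *\<^sub>R u \<in> V" using V vV uV by (intro subspace_add subspace_scale)
    from min[OF this] have "0 \<le> (v + t *\<^sub>R u) \<bullet> T (v + t *\<^sub>R u) - e * ((v + t *\<^sub>R u) \<bullet> (v + t *\<^sub>R u))"
      by simp
    also have "\<dots> = (v \<bullet> T v - e * (v \<bullet> v)) + 2 * t * (u \<bullet> T v - e * (u \<bullet> v)) + t\<^sup>2 * c"
      using adj[of v u]
      by (simp add: linear_add[OF lin] linear_scale[OF lin] inner_simps c_def algebra_simps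
          power2_eq_square inner_commute)
    also have "u \<bullet> T v - e * (u \<bullet> v) = u \<bullet> u"
      unfolding u_def by (simp add: inner_simps)
    finally show ?thesis by (simp add: e_def vv)
  qed
  have "u \<bullet> u = 0"
  proof (rule ccontr)
    assume "u \<bullet> u \<noteq> 0"
    then have pos: "u \<bullet> u > 0" by simp
    \<comment> \<open>With this negative \<open>t\<close> the quadratic term cancels at most half of
      the linear one; the \<open>+ 1\<close> avoids division by zero when
      \<open>c = 0\<close>.\<close>
    define t where "t = - (u \<bullet> u) / (\<bar>c\<bar> + 1)"
    have "2 * t * (u \<bullet> u) + t\<^sup>2 * c \<le> 2 * t * (u \<bullet> u) + t\<^sup>2 * (\<bar>c\<bar> + 1)"
      by (intro add_left_mono mult_left_mono) auto
    also have "t\<^sup>2 * (\<bar>c\<bar> + 1) = t * (t * (\<bar>c\<bar> + 1))"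
      by (simp add: power2_eq_square)
    also have "t * (\<bar>c\<bar> + 1) = - (u \<bullet> u)"
      unfolding t_def by (simp add: nonzero_divide_eq_eq)
    also have "2 * t * (u \<bullet> u) + t * - (u \<bullet> u) = t * (u \<bullet> u)" by simp
    also have "\<dots> < 0" using pos by (simp add: t_def mult_neg_pos)
    finally show False using perturb[of t] by simp
  qed
  then have "T v = e *\<^sub>R v" by (simp add: u_def)
  moreover have "v \<noteq> 0" using vv by auto
  ultimately show thesis using that vV min by blast
qed

text \<open>Eigenvectors for distinct eigenvalues are orthogonal, and a pairwise orthogonal set in a
  Euclidean space is finite. Choosing one eigenvector per eigenvalue is injective, since a nonzero
  vector is not orthogonal to itself.\<close>

lemma finite_eigenvalues_self_adjoint:
  fixes T :: "'a::euclidean_space \<Rightarrow> 'a"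
  assumes adj: "\<And>v w. T v \<bullet> w = v \<bullet> T w"
  shows "finite {e. \<exists>v. v \<noteq> 0 \<and> T v = e *\<^sub>R v}"
proof -
  let ?E = "{e. \<exists>v. v \<noteq> 0 \<and> T v = e *\<^sub>R v}"
  define v where "v e = (SOME v. v \<noteq> 0 \<and> T v = e *\<^sub>R v)" for e
  have v: "v e \<noteq> 0 \<and> T (v e) = e *\<^sub>R v e" if "e \<in> ?E" for e
    unfolding v_def by (rule someI_ex) (use that in simp)
  have orth: "v d \<bullet> v e = 0" if "d \<in> ?E" "e \<in> ?E" "d \<noteq> e" for d e
    using adj[of "v d" "v e"] v[OF that(1)] v[OF that(2)] that(3) by simp
  have "inj_on v ?E"
  proof (rule inj_onI, rule ccontr)
    fix d e assume "d \<in> ?E" "e \<in> ?E" "v d = v e" "d \<noteq> e"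
    then have "v e \<bullet> v e = 0" using orth[of d e] by simp
    then show False using v[OF \<open>e \<in> ?E\<close>] by simp
  qed
  moreover have "pairwise orthogonal (v ` ?E)"
    unfolding pairwise_image using orth by (simp add: pairwise_def orthogonal_def)
  then have "finite (v ` ?E)"
    by (rule pairwise_orthogonal_imp_finite)
  ultimately show ?thesis using finite_imageD by blast
qed

section \<open>Restricted vectors and smallest eigenvalues of principal submatrices\<close>

lemma restr_nth [simp]: "restr v N $ j = (if j \<in> N then v $ j else 0)"
  by (simp add: restr_def)

lemma restr_restr [simp]: "restr (restr v N) N = restr v N"
  by (simp add: vec_eq_iff)

lemma linear_restr: "linear (\<lambda>v. restr v N)"
  by (rule linearI) (simp_all add: vec_eq_iff)

lemma inner_restr: "restr v N \<bullet> w = v \<bullet> restr w N"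
  unfolding inner_vec_def by (rule sum.cong) auto

lemma norm_restr_power2: "(norm (restr \<beta> N))\<^sup>2 = (\<Sum>j\<in>N. (\<beta> $ j)\<^sup>2)"
proof -
  have "(norm (restr \<beta> N))\<^sup>2 = (\<Sum>j\<in>UNIV. if j \<in> N then (\<beta> $ j)\<^sup>2 else 0)"
    unfolding power2_norm_eq_inner inner_vec_def
    by (rule sum.cong) (auto simp: power2_eq_square)
  then show ?thesis by (simp add: sum.If_cases)
qed

lemma norm_restr: "norm (restr \<beta> N) = sqrt (\<Sum>j\<in>N. (\<beta> $ j)\<^sup>2)"
  by (metis norm_ge_zero norm_restr_power2 real_sqrt_abs abs_of_nonneg)

text \<open>The submatrix acts as the compression \<open>T\<close> of \<open>A\<close> to the space
  \<open>V\<close> of vectors supported in \<open>N\<close>. The minimum \<open>e\<close> of the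
  Rayleigh quotient on \<open>V\<close> is one of its eigenvalues, hence at least the smallest
  one.\<close>

lemma smallest_eigenvalue_le_rayleigh:
  fixes A :: "real ^ 'p ^ 'p" and N :: "'p::finite set"
  assumes sym: "transpose A = A" and ne: "N \<noteq> {}"
  shows "smallest_eigenvalue A N * (norm (restr w N))\<^sup>2 \<le> restr w N \<bullet> (A *v restr w N)"
proof -
  define T where "T v = restr (A *v restr v N) N" for v
  define V where "V = {v :: real ^ 'p. restr v N = v}"
  have lin: "linear T"
    unfolding T_def
    using linear_compose[OF linear_compose[OF linear_restr matrix_vector_mul_linear[of A]]
        linear_restr] by (simp add: o_def)
  have adj: "T v \<bullet> w = v \<bullet> T w" for v w
    unfolding T_def inner_restr using dot_lmul_matrix[of "restr v N" A "restr w N"] sym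
    by (metis inner_restr transpose_matrix_vector)
  have V: "subspace V"
    unfolding V_def subspace_def
    by (auto simp: linear_add[OF linear_restr] linear_scale[OF linear_restr] linear_0[OF linear_restr])
  have inv: "T v \<in> V" for v by (simp add: V_def T_def)
  obtain j where "j \<in> N" using ne by blast
  then have "restr 1 N \<in> V" "restr 1 N \<noteq> 0"
    by (auto simp: V_def vec_eq_iff)
  then have "\<exists>v\<in>V. v \<noteq> 0" by blast
  with self_adjoint_min_eigenvector[OF lin adj V inv] obtain e v
    where v: "v \<in> V" "v \<noteq> 0" "T v = e *\<^sub>R v"
      and min: "\<And>w. w \<in> V \<Longrightarrow> e * (w \<bullet> w) \<le> w \<bullet> T w" by metis
  have mult: "(A *v restr v N) $ j = (\<Sum>k\<in>N. A $ j $ k * v $ k)" for v j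
    by (simp add: matrix_vector_mult_def if_distrib sum.If_cases cong: if_cong)
  \<comment> \<open>Extension by zero turns submatrix eigenvectors into eigenvectors of
    \<open>T\<close>. This gives the finiteness without which \<open>Min\<close> would carry no
    information.\<close>
  have "submatrix_eigenvalues A N \<subseteq> {e. \<exists>v. v \<noteq> 0 \<and> T v = e *\<^sub>R v}"
  proof
    fix d assume "d \<in> submatrix_eigenvalues A N"
    then obtain u where u: "\<exists>j\<in>N. u j \<noteq> 0" "\<And>j. j \<in> N \<Longrightarrow> (\<Sum>k\<in>N. A $ j $ k * u k) = d * u j"
      unfolding submatrix_eigenvalues_def by blast
    let ?u = "restr (\<chi> j. u j) N"
    have "?u \<noteq> 0" using u(1) by (auto simp: vec_eq_iff)
    moreover have "T ?u = d *\<^sub>R ?u"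
      by (auto simp: T_def vec_eq_iff mult u(2))
    ultimately show "d \<in> {e. \<exists>v. v \<noteq> 0 \<and> T v = e *\<^sub>R v}" by blast
  qed
  then have "finite (submatrix_eigenvalues A N)"
    using finite_eigenvalues_self_adjoint[of T] adj finite_subset by blast
  \<comment> \<open>Here \<open>v \<in> V\<close> matters: nonzero vectors vanishing on
    \<open>N\<close> are eigenvectors of \<open>T\<close> for 0, but are no eigenvectors of the
    submatrix.\<close>
  moreover have "e \<in> submatrix_eigenvalues A N"
  proof -
    have "\<exists>j\<in>N. v $ j \<noteq> 0"
      using v(1,2) by (auto simp: V_def vec_eq_iff split: if_splits)
    moreover have "(\<Sum>k\<in>N. A $ j $ k * v $ k) = e * v $ j" if "j \<in> N" for j
      using arg_cong[OF v(3), of "\<lambda>x. x $ j"] that by (simp add: T_def mult)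
    ultimately show ?thesis unfolding submatrix_eigenvalues_def by blast
  qed
  ultimately have "smallest_eigenvalue A N \<le> e"
    unfolding smallest_eigenvalue_def by (rule Min_le)
  then have "smallest_eigenvalue A N * (norm (restr w N))\<^sup>2 \<le> e * (restr w N \<bullet> restr w N)"
    by (simp add: power2_norm_eq_inner mult_right_mono)
  also have "\<dots> \<le> restr w N \<bullet> T (restr w N)"
    by (rule min) (simp add: V_def)
  also have "\<dots> = restr w N \<bullet> (A *v restr w N)"
    by (simp add: T_def inner_restr[symmetric])
  finally show ?thesis .
qed

lemma Lambda_sq_le:
  fixes A :: "real ^ 'p ^ 'p" and N :: "'p::finite set"
  assumes "S \<subseteq> N" "card N \<le> n"
  shows "Lambda_sq A S n \<le> smallest_eigenvalue A N"
  unfolding Lambda_sq_def using assms by (intro cINF_lower bdd_below_finite) auto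

section \<open>L2 inner products as Gram matrix forms\<close>

text \<open>Domination by the sum of the squares. This justifies exchanging the integral with the
  finite double sum in \<open>l2_inner_lin_comb\<close>.\<close>

lemma square_integrable_mult:
  assumes "square_integrable Q f" "square_integrable Q g"
  shows "integrable Q (\<lambda>x. f x * g x)"
proof (rule Bochner_Integration.integrable_bound)
  show "integrable Q (\<lambda>x. (f x)\<^sup>2 + (g x)\<^sup>2)"
    using assms by (simp add: square_integrable_def)
  show "(\<lambda>x. f x * g x) \<in> borel_measurable Q"
    using assms by (auto simp: square_integrable_def)
  have "\<bar>a * b\<bar> \<le> \<bar>a\<^sup>2 + b\<^sup>2\<bar>" for a b :: real
  proof -
    have "0 \<le> (\<bar>a\<bar> - \<bar>b\<bar>)\<^sup>2" "0 \<le> \<bar>a * b\<bar>" by simp_all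
    moreover have "(\<bar>a\<bar> - \<bar>b\<bar>)\<^sup>2 = a\<^sup>2 + b\<^sup>2 - 2 * \<bar>a * b\<bar>"
      by (simp add: power2_diff abs_mult)
    ultimately show ?thesis by linarith
  qed
  then show "AE x in Q. norm (f x * g x) \<le> norm ((f x)\<^sup>2 + (g x)\<^sup>2)" by simp
qed

lemma l2_inner_lin_comb:
  fixes \<psi> :: "'p::finite \<Rightarrow> 'a \<Rightarrow> real"
  assumes "\<And>j. square_integrable Q (\<psi> j)"
  shows "l2_inner Q (lin_comb \<psi> a) (lin_comb \<psi> b) = a \<bullet> (gram Q \<psi> *v b)"
proof -
  have "l2_inner Q (lin_comb \<psi> a) (lin_comb \<psi> b)
      = (LINT x|Q. (\<Sum>j\<in>UNIV. \<Sum>k\<in>UNIV. (a $ j * b $ k) * (\<psi> j x * \<psi> k x)))"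
    unfolding l2_inner_def lin_comb_def sum_product by (simp add: mult_ac)
  also have "\<dots> = (\<Sum>j\<in>UNIV. \<Sum>k\<in>UNIV. (a $ j * b $ k) * gram Q \<psi> $ j $ k)"
    using square_integrable_mult[OF assms assms]
    by (simp add: Bochner_Integration.integral_sum gram_def l2_inner_def)
  finally show ?thesis
    by (simp add: inner_vec_def matrix_vector_mult_def sum_distrib_left mult_ac)
qed

lemma transpose_gram: "transpose (gram Q \<psi>) = gram Q \<psi>"
  by (simp add: vec_eq_iff transpose_def gram_def l2_inner_def mult.commute)

lemma l2_norm_lin_comb_power2:
  fixes \<psi> :: "'p::finite \<Rightarrow> 'a \<Rightarrow> real"
  assumes "\<And>j. square_integrable Q (\<psi> j)"
  shows "(l2_norm Q (lin_comb \<psi> a))\<^sup>2 = a \<bullet> (gram Q \<psi> *v a)"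
proof -
  \<comment> \<open>Nonnegativity lets the square undo the \<open>sqrt\<close> in
    \<open>l2_norm\<close>.\<close>
  have "0 \<le> l2_inner Q (lin_comb \<psi> a) (lin_comb \<psi> a)"
    unfolding l2_inner_def by (rule integral_nonneg_AE) simp
  then show ?thesis
    by (simp add: l2_norm_def l2_inner_lin_comb[OF assms])
qed

section \<open>Bounding the regression ratio\<close>

lemma regression_numerator_le:
  fixes \<psi> :: "'p::finite \<Rightarrow> 'a \<Rightarrow> real"
  assumes L2: "\<And>j. square_integrable Q (\<psi> j)"
    and M: "0 \<le> M" "\<And>j. j \<notin> N \<Longrightarrow> \<bar>\<beta> $ j\<bar> \<le> M"
  shows "\<bar>l2_inner Q (lin_comb \<psi> (restr \<beta> N)) (lin_comb \<psi> (restr \<beta> (- N)))\<bar>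
    \<le> M * norm (restr \<beta> N) * sqrt (\<Sum>k\<in>N. (\<Sum>j\<in>- N. \<bar>gram Q \<psi> $ j $ k\<bar>)\<^sup>2)"
proof -
  define a where "a k = (\<Sum>j\<in>- N. \<bar>gram Q \<psi> $ j $ k\<bar>)" for k
  have "l2_inner Q (lin_comb \<psi> (restr \<beta> N)) (lin_comb \<psi> (restr \<beta> (- N)))
      = (\<Sum>k\<in>N. \<beta> $ k * (\<Sum>j\<in>- N. gram Q \<psi> $ k $ j * \<beta> $ j))"
    unfolding l2_inner_lin_comb[OF L2]
    by (simp add: inner_vec_def matrix_vector_mult_def if_distrib if_distribR sum.If_cases
        Compl_eq cong: if_cong)
  also have "\<bar>\<dots>\<bar> \<le> (\<Sum>k\<in>N. \<bar>\<beta> $ k\<bar> * (M * a k))"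
  proof (rule sum_abs[THEN order_trans], rule sum_mono)
    fix k
    have "\<bar>\<Sum>j\<in>- N. gram Q \<psi> $ k $ j * \<beta> $ j\<bar> \<le> (\<Sum>j\<in>- N. \<bar>gram Q \<psi> $ k $ j\<bar> * M)"
      by (rule sum_abs[THEN order_trans], rule sum_mono) (auto simp: abs_mult M intro!: mult_left_mono)
    \<comment> \<open>Symmetry of the Gram matrix, from commutativity under the integral, swaps the
      two indices.\<close>
    also have "\<dots> = M * a k"
      by (simp add: a_def sum_distrib_left gram_def l2_inner_def mult.commute)
    finally show "\<bar>\<beta> $ k * (\<Sum>j\<in>- N. gram Q \<psi> $ k $ j * \<beta> $ j)\<bar> \<le> \<bar>\<beta> $ k\<bar> * (M * a k)"
      by (simp add: abs_mult mult_left_mono)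
  qed
  \<comment> \<open>The absolute value of \<open>a k \<ge> 0\<close> is inserted to match the
    Cauchy-Schwarz inequality \<open>L2_set_mult_ineq\<close>.\<close>
  also have "\<dots> = M * (\<Sum>k\<in>N. \<bar>\<beta> $ k\<bar> * \<bar>a k\<bar>)"
    by (simp add: sum_distrib_left mult_ac a_def sum_nonneg)
  also have "\<dots> \<le> M * (L2_set (\<lambda>k. \<beta> $ k) N * L2_set a N)"
    by (intro mult_left_mono L2_set_mult_ineq M)
  finally show ?thesis
    by (simp add: L2_set_def norm_restr a_def mult_ac)
qed

text \<open>Common to both claims, with \<open>c\<close> equal to the square root of
  \<open>card S\<close> in the adaptive case and to its reciprocal in the restricted one. The
  numerator carries two factors \<open>norm (restr \<beta> N)\<close>, one from \<open>c\<close> and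
  one from Cauchy-Schwarz, which cancel against the eigenvalue bound.\<close>

lemma regression_ratio_le:
  fixes \<psi> :: "'p::finite \<Rightarrow> 'a \<Rightarrow> real"
  assumes L2: "\<And>j. square_integrable Q (\<psi> j)"
    and N: "S \<noteq> {}" "S \<subseteq> N" "card N \<le> n"
    and \<Lambda>: "Lambda_sq (gram Q \<psi>) S n > 0"
    and nz: "l2_norm Q (lin_comb \<psi> (restr \<beta> N)) \<noteq> 0"
    and c: "0 \<le> c" "\<And>j. j \<notin> N \<Longrightarrow> \<bar>\<beta> $ j\<bar> \<le> c * norm (restr \<beta> N)"
  shows "regression_ratio Q \<psi> N \<beta>
    \<le> c * sqrt (\<Sum>k\<in>N. (\<Sum>j\<in>- N. \<bar>gram Q \<psi> $ j $ k\<bar>)\<^sup>2) / Lambda_sq (gram Q \<psi>) S n"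
    (is "_ \<le> c * ?R / ?\<Lambda>")
proof -
  let ?b = "norm (restr \<beta> N)"
  \<comment> \<open>A zero coefficient vector would give a zero function; positivity of its norm is
    needed for the final cancellation.\<close>
  have "restr \<beta> N \<noteq> 0"
    using nz l2_norm_lin_comb_power2[OF L2, where a = "restr \<beta> N"] by auto
  then have b: "?b > 0" by simp
  have "?\<Lambda> * ?b\<^sup>2 \<le> smallest_eigenvalue (gram Q \<psi>) N * ?b\<^sup>2"
    by (intro mult_right_mono Lambda_sq_le N) simp
  also have "\<dots> \<le> (l2_norm Q (lin_comb \<psi> (restr \<beta> N)))\<^sup>2"
    unfolding l2_norm_lin_comb_power2[OF L2]
    using N by (intro smallest_eigenvalue_le_rayleigh transpose_gram) auto
  finally have denom: "?\<Lambda> * ?b\<^sup>2 \<le> (l2_norm Q (lin_comb \<psi> (restr \<beta> N)))\<^sup>2" .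
  have "regression_ratio Q \<psi> N \<beta> \<le> (c * ?b * ?b * ?R) / (?\<Lambda> * ?b\<^sup>2)"
    unfolding regression_ratio_def
    using regression_numerator_le[where \<psi> = \<psi>, OF L2, where M = "c * ?b" and N = N and \<beta> = \<beta>] c denom \<Lambda> b
    by (intro frac_le) (auto intro!: mult_nonneg_nonneg sum_nonneg)
  also have "\<dots> = c * ?R / ?\<Lambda>"
    using b by (simp add: power2_eq_square)
  finally show ?thesis .
qed

lemma abs_le_l1_norm_restr:
  assumes "j \<in> N"
  shows "\<bar>\<beta> $ j\<bar> \<le> l1_norm (restr \<beta> N)"
  using member_le_sum[of j UNIV "\<lambda>j. \<bar>restr \<beta> N $ j\<bar>"] assms by (simp add: l1_norm_def)

text \<open>Every squared coefficient on \<open>N - S\<close> is at least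
  \<open>(\<beta> $ j)\<^sup>2\<close>, so summing them suffices. Strict inclusion excludes the
  alternative \<open>N = S\<close>, where the cone gives no minimum condition.\<close>

lemma restricted_cone_abs_le:
  fixes S N :: "'p::finite set"
  assumes "\<beta> \<in> restricted_cone S N" "S \<subset> N" "j \<notin> N"
  shows "sqrt (real (card (N - S))) * \<bar>\<beta> $ j\<bar> \<le> norm (restr \<beta> N)"
proof -
  have "\<bar>\<beta> $ j\<bar> \<le> infnorm (restr \<beta> (- N))"
    using component_le_infnorm_cart[of "restr \<beta> (- N)" j] assms(3) by simp
  also have "\<dots> \<le> Min ((\<lambda>j. \<bar>\<beta> $ j\<bar>) ` (N - S))"
    using assms by (auto simp: restricted_cone_def)
  finally have le: "\<bar>\<beta> $ j\<bar> \<le> \<bar>\<beta> $ i\<bar>" if "i \<in> N - S" for i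
    using that by (meson Min_le finite finite_imageI imageI order_trans)
  have "real (card (N - S)) * (\<beta> $ j)\<^sup>2 \<le> (\<Sum>i\<in>N - S. (\<beta> $ i)\<^sup>2)"
    using sum_mono[of "N - S" "\<lambda>_. (\<beta> $ j)\<^sup>2" "\<lambda>i. (\<beta> $ i)\<^sup>2"] le by (simp add: abs_le_square_iff)
  also have "\<dots> \<le> (\<Sum>i\<in>N. (\<beta> $ i)\<^sup>2)"
    by (intro sum_mono2) auto
  finally have "sqrt (real (card (N - S)) * (\<beta> $ j)\<^sup>2) \<le> norm (restr \<beta> N)"
    unfolding norm_restr by (rule real_sqrt_le_mono)
  then show ?thesis by (simp add: real_sqrt_mult)
qed

theorem corollary4p2:
  fixes Q :: "'a measure"
    and \<psi> :: "'p::finite \<Rightarrow> 'a \<Rightarrow> real"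
    and S :: "'p set"
  assumes "prob_space Q"
    and "\<And>j. square_integrable Q (\<psi> j)"
    and "S \<noteq> {}"
    and "CARD('p) \<ge> 2 * card S"
    and "Lambda_sq (gram Q \<psi>) S (card S) > 0"
  shows "theta_adaptive Q \<psi> S \<le> ereal (theta_cumulative Q \<psi> S) \<and>
    (Lambda_sq (gram Q \<psi>) S (2 * card S) > 0 \<longrightarrow>
      theta_restricted Q \<psi> S (2 * card S)
        \<le> ereal (Max ((\<lambda>N. sqrt (\<Sum>k\<in>N. (\<Sum>j\<in>- N. \<bar>gram Q \<psi> $ j $ k\<bar>)\<^sup>2)
                          / (sqrt (real (card S)) * Lambda_sq (gram Q \<psi>) S (2 * card S)))
                     ` {N. S \<subseteq> N \<and> card N = 2 * card S})))"
proof (intro conjI impI)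
  show "theta_adaptive Q \<psi> S \<le> ereal (theta_cumulative Q \<psi> S)"
    unfolding theta_adaptive_def
  proof (rule Sup_least, clarify)
    fix \<beta> :: "real ^ 'p"
    assume le: "l1_norm (restr \<beta> (- S)) \<le> sqrt (real (card S)) * norm (restr \<beta> S)"
      and "l2_norm Q (lin_comb \<psi> (restr \<beta> S)) \<noteq> 0"
    \<comment> \<open>One coordinate is at most the l1 norm, so the adaptive constraint supplies
      \<open>c\<close>.\<close>
    moreover have "\<bar>\<beta> $ j\<bar> \<le> sqrt (real (card S)) * norm (restr \<beta> S)" if "j \<notin> S" for j
      using abs_le_l1_norm_restr[of j "- S" \<beta>] that le by simp
    ultimately show "ereal (regression_ratio Q \<psi> S \<beta>) \<le> ereal (theta_cumulative Q \<psi> S)"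
      unfolding theta_cumulative_def ereal_less_eq
      using assms by (intro regression_ratio_le) auto
  qed
next
  assume \<Lambda>: "Lambda_sq (gram Q \<psi>) S (2 * card S) > 0"
  let ?B = "\<lambda>N. sqrt (\<Sum>k\<in>N. (\<Sum>j\<in>- N. \<bar>gram Q \<psi> $ j $ k\<bar>)\<^sup>2)
    / (sqrt (real (card S)) * Lambda_sq (gram Q \<psi>) S (2 * card S))"
  have s: "card S > 0" using assms(3) by (simp add: card_gt_0_iff)
  show "theta_restricted Q \<psi> S (2 * card S)
      \<le> ereal (Max (?B ` {N. S \<subseteq> N \<and> card N = 2 * card S}))"
    unfolding theta_restricted_def
  proof (rule Sup_least, clarify)
    fix N and \<beta> :: "real ^ 'p"
    assume N: "S \<subseteq> N" "card N = 2 * card S" and \<beta>: "\<beta> \<in> restricted_cone S N"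
      and nz: "l2_norm Q (lin_comb \<psi> (restr \<beta> N)) \<noteq> 0"
    \<comment> \<open>Since \<open>card S > 0\<close>, the sizes \<open>card S\<close> and
      \<open>2 * card S\<close> differ; their difference \<open>card S\<close> then yields the
      constant \<open>1 / sqrt (real (card S))\<close>.\<close>
    have "S \<subset> N" using N s by auto
    moreover have "card (N - S) = card S" using N by (simp add: card_Diff_subset)
    ultimately have "\<bar>\<beta> $ j\<bar> \<le> 1 / sqrt (real (card S)) * norm (restr \<beta> N)" if "j \<notin> N" for j
      using restricted_cone_abs_le[OF \<beta> _ that] s by (simp add: field_simps)
    then have "regression_ratio Q \<psi> N \<beta>
        \<le> 1 / sqrt (real (card S)) * sqrt (\<Sum>k\<in>N. (\<Sum>j\<in>- N. \<bar>gram Q \<psi> $ j $ k\<bar>)\<^sup>2)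
          / Lambda_sq (gram Q \<psi>) S (2 * card S)"
      using assms N \<Lambda> nz by (intro regression_ratio_le) auto
    also have "\<dots> = ?B N" by simp
    also have "\<dots> \<le> Max (?B ` {N. S \<subseteq> N \<and> card N = 2 * card S})"
      using N by (intro Max_ge) auto
    finally show "ereal (regression_ratio Q \<psi> N \<beta>)
        \<le> ereal (Max (?B ` {N. S \<subseteq> N \<and> card N = 2 * card S}))" by simp
  qed
qed

end
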